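(* Let $M\ge 1$ be an integer, $N=2M-1$, and $D=\operatorname{diag}(1,3,5,\dots,N)$. Let $L_b$ be the $M\times M$ lower-triangular matrix whose rows are, from top to bottom, the Hermite coefficient vectors $\beta_{1,N},\beta_{3,N},\dots,\beta_{N,N}$, and let $L_a$ be the $M\times M$ lower-triangular matrix whose rows are, from top to bottom, $\beta_{0,N},\beta_{2,N},\dots,\beta_{N-1,N}$. Then $$L_bD=DL_a.$$
   Context: The Hermite polynomials are $H_n(x)=(-1)^n e^{x^2/2}\frac{d^n}{dx^n}e^{-x^2/2}$ for $n\ge 0$ (so $H_0=1$, $H_1=x$, $H_2=x^2-1$, $H_3=x^3-3x$). Let $z(x)=(1,x^2,x^4,\dots,x^{N-1})$, a row vector of length $M$. For $1\le m\le M$, the row vectors $\beta_{2m-1,N},\beta_{2m-2,N}\in\mathbb{R}^M$ are defined by the polynomial identities $H_{2m-1}(x)=x\,\beta_{2m-1,N}\,z(x)^{T}$ and $H_{2m-2}(x)=\beta_{2m-2,N}\,z(x)^{T}$. For example, $\beta_{3,N}=(-3,1,0,\dots,0)$ and $\beta_{4,N}=(3,-6,1,0,\dots,0)$ (when $M$ is large enough for these to be defined). *)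

theory Defs
  imports "HOL-Analysis.Analysis" "HOL-Computational_Algebra.Polynomial" "Jordan_Normal_Form.Matrix"
begin

unbundle no vec_syntax

definition hermite :: "nat \<Rightarrow> real \<Rightarrow> real" where
  "hermite n x = (-1) ^ n * exp (x\<^sup>2 / 2) * (deriv ^^ n) (\<lambda>t. exp (- t\<^sup>2 / 2)) x"

text \<open>The vector \<open>z(x) = (1, x\<^sup>2, x\<^sup>4, \<dots>, x\<^bsup>N-1\<^esup>)\<close> has length \<open>M = (N + 1) / 2\<close>
  for odd \<open>N = 2 * M - 1\<close>.\<close>

definition zvec :: "nat \<Rightarrow> real \<Rightarrow> real vec" where
  "zvec N x = vec ((N + 1) div 2) (\<lambda>i. x ^ (2 * i))"

text \<open>The Hermite coefficient vector \<open>\<beta>\<^bsub>k,N\<^esub>\<close>. It is meaningful for \<open>k \<le> N\<close>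
  and odd \<open>N\<close>, in which case the description is satisfied by exactly one vector;
  see \<open>hermite_odd_coeffs_ex1\<close> and \<open>hermite_even_coeffs_ex1\<close> below.\<close>

definition hermite_coeffs :: "nat \<Rightarrow> nat \<Rightarrow> real vec" where
  "hermite_coeffs k N =
    (if odd k
     then (THE b. b \<in> carrier_vec ((N + 1) div 2) \<and> (\<forall>x. hermite k x = x * (b \<bullet> zvec N x)))
     else (THE b. b \<in> carrier_vec ((N + 1) div 2) \<and> (\<forall>x. hermite k x = b \<bullet> zvec N x)))"

lemma hermite_poly_ex:
  "\<exists>Q R. degree Q \<le> j \<and> degree R \<le> j \<and>
     (\<forall>x. hermite (2 * j) x = poly Q (x\<^sup>2)) \<and> (\<forall>x. hermite (2 * j + 1) x = x * poly R (x\<^sup>2))"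
proof -
  define g :: "real \<Rightarrow> real" where "g = (\<lambda>t. exp (- t\<^sup>2 / 2))"
  have her: "hermite n x = p x" if "\<And>x. (deriv ^^ n) g x = (-1) ^ n * p x * g x" for n p x
  proof -
    have "exp (x\<^sup>2 / 2) * g x = 1"
      by (simp add: g_def flip: exp_add)
    then have "hermite n x = ((-1) ^ n * (-1) ^ n) * p x"
      unfolding hermite_def g_def[symmetric] that[of x] by (simp add: algebra_simps)
    then show ?thesis
      by (simp flip: power_mult_distrib)
  qed
  have dg: "(g has_real_derivative - x * g x) (at x)" for x
    unfolding g_def by (auto intro!: derivative_eq_intros)
  have dP: "((\<lambda>x. poly P (x\<^sup>2)) has_real_derivative 2 * x * poly (pderiv P) (x\<^sup>2)) (at x)" for P x
  proof -
    have "((\<lambda>x. x\<^sup>2) has_real_derivative 2 * x) (at x)"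
      by (auto intro!: derivative_eq_intros)
    from DERIV_chain2[OF poly_DERIV this] show ?thesis
      by (simp add: mult_ac)
  qed
  have step_odd: "(deriv ^^ Suc (2 * j)) g x = - (x * poly (Q - Polynomial.smult 2 (pderiv Q)) (x\<^sup>2)) * g x"
    if "\<And>x. (deriv ^^ (2 * j)) g x = poly Q (x\<^sup>2) * g x" for j Q x
  proof -
    have "(deriv ^^ Suc (2 * j)) g = deriv (\<lambda>x. poly Q (x\<^sup>2) * g x)"
      using arg_cong[where f = deriv, OF ext[OF that]] by simp
    moreover have "((\<lambda>x. poly Q (x\<^sup>2) * g x) has_real_derivative
        - (x * poly (Q - Polynomial.smult 2 (pderiv Q)) (x\<^sup>2)) * g x) (at x)"
      using DERIV_mult[OF dP dg, of Q x] by (simp add: algebra_simps)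
    ultimately show ?thesis
      by (simp add: DERIV_imp_deriv)
  qed
  have step_even: "(deriv ^^ Suc (Suc (2 * j))) g x
      = poly ([:-1, 1:] * R - Polynomial.smult 2 ([:0, 1:] * pderiv R)) (x\<^sup>2) * g x"
    if "\<And>x. (deriv ^^ Suc (2 * j)) g x = - (x * poly R (x\<^sup>2)) * g x" for j R x
  proof -
    have "(deriv ^^ Suc (Suc (2 * j))) g = deriv (\<lambda>x. - (x * poly R (x\<^sup>2)) * g x)"
      using arg_cong[where f = deriv, OF ext[OF that]] by simp
    moreover have "((\<lambda>x. - (x * poly R (x\<^sup>2)) * g x) has_real_derivative
        poly ([:-1, 1:] * R - Polynomial.smult 2 ([:0, 1:] * pderiv R)) (x\<^sup>2) * g x) (at x)"
      using DERIV_mult[OF DERIV_minus[OF DERIV_mult[OF DERIV_ident dP]] dg, of R x]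
      by (simp add: algebra_simps power2_eq_square)
    ultimately show ?thesis
      by (simp add: DERIV_imp_deriv)
  qed
  have "\<exists>Q. degree Q \<le> j \<and> (\<forall>x. (deriv ^^ (2 * j)) g x = poly Q (x\<^sup>2) * g x)" for j
  proof (induction j)
    case 0
    show ?case by (rule exI[of _ 1]) simp
  next
    case (Suc j)
    then obtain Q where Q: "degree Q \<le> j" "\<And>x. (deriv ^^ (2 * j)) g x = poly Q (x\<^sup>2) * g x"
      by blast
    define R where "R = Q - Polynomial.smult 2 (pderiv Q)"
    have R: "degree R \<le> j"
      using Q(1) unfolding R_def
      by (intro degree_diff_le order.trans[OF Polynomial.degree_smult_le]) (auto simp: degree_pderiv)
    let ?S = "[:-1, 1:] * R - Polynomial.smult 2 ([:0, 1:] * pderiv R)"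
    have "degree ?S \<le> Suc j"
      using R
      by (intro degree_diff_le order.trans[OF Polynomial.degree_smult_le] order.trans[OF degree_mult_le])
        (auto simp: degree_pderiv)
    moreover have "(deriv ^^ (2 * Suc j)) g x = poly ?S (x\<^sup>2) * g x" for x
      using step_even[OF step_odd[OF Q(2), folded R_def], of x] by simp
    ultimately show ?case by blast
  qed
  then obtain Q where Q: "degree Q \<le> j" "\<And>x. (deriv ^^ (2 * j)) g x = poly Q (x\<^sup>2) * g x"
    by blast
  define R where "R = Q - Polynomial.smult 2 (pderiv Q)"
  have "degree R \<le> j"
    using Q(1) unfolding R_def
    by (intro degree_diff_le order.trans[OF Polynomial.degree_smult_le]) (auto simp: degree_pderiv)
  moreover have "hermite (2 * j) x = poly Q (x\<^sup>2)" for x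
    by (rule her) (use Q(2) in simp)
  moreover have "hermite (2 * j + 1) x = x * poly R (x\<^sup>2)" for x
    by (rule her) (use step_odd[OF Q(2), folded R_def] in simp)
  ultimately show ?thesis
    using Q(1) by blast
qed

lemma scalar_prod_zvec:
  assumes "b \<in> carrier_vec ((N + 1) div 2)"
  shows "b \<bullet> zvec N x = poly (\<Sum>i<(N + 1) div 2. monom (b $ i) i) (x\<^sup>2)"
  using assms
  by (simp add: scalar_prod_def zvec_def poly_sum poly_monom power_mult atLeast0LessThan)

lemma zvec_coeffs_eqI:
  assumes "b \<in> carrier_vec ((N + 1) div 2)" "c \<in> carrier_vec ((N + 1) div 2)"
    and eq: "\<And>x. x > 0 \<Longrightarrow> b \<bullet> zvec N x = c \<bullet> zvec N x"
  shows "b = c"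
proof -
  let ?p = "\<lambda>b :: real vec. \<Sum>i<(N + 1) div 2. monom (b $ i) i"
  have "poly (?p b - ?p c) t = 0" if "t > 0" for t
    using eq[of "sqrt t"] that
    by (simp only: scalar_prod_zvec[OF assms(1)] scalar_prod_zvec[OF assms(2)]) simp
  then have "{0<..} \<subseteq> {t. poly (?p b - ?p c) t = 0}"
    by blast
  then have "infinite {t. poly (?p b - ?p c) t = 0}"
    using infinite_Ioi finite_subset by blast
  then have "?p b = ?p c"
    using poly_roots_finite[of "?p b - ?p c"] by auto
  then have "coeff (?p b) i = coeff (?p c) i" for i
    by simp
  then have "b $ i = c $ i" if "i < (N + 1) div 2" for i
    using that by (simp add: coeff_sum split: if_splits) metis
  then show ?thesis
    using assms(1,2) by auto
qed

lemma poly_eq_scalar_prod_zvec: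
  assumes "degree Q < (N + 1) div 2"
  shows "poly Q (x\<^sup>2) = vec ((N + 1) div 2) (coeff Q) \<bullet> zvec N x"
proof -
  have "poly Q (x\<^sup>2) = (\<Sum>i<(N + 1) div 2. coeff Q i * x\<^sup>2 ^ i)"
    unfolding poly_altdef using assms
    by (intro sum.mono_neutral_left) (auto simp: coeff_eq_0)
  then show ?thesis
    by (simp add: scalar_prod_def zvec_def power_mult atLeast0LessThan)
qed

lemma hermite_odd_coeffs_ex1:
  assumes "odd k" "k \<le> N"
  shows "\<exists>!b. b \<in> carrier_vec ((N + 1) div 2) \<and> (\<forall>x. hermite k x = x * (b \<bullet> zvec N x))"
proof -
  from assms obtain j where k: "k = 2 * j + 1" by (elim oddE)
  with assms have j: "j < (N + 1) div 2" by auto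
  from hermite_poly_ex[of j] obtain R
    where "degree R \<le> j" "\<And>x. hermite k x = x * poly R (x\<^sup>2)"
    unfolding k by blast
  then have "hermite k x = x * (vec ((N + 1) div 2) (coeff R) \<bullet> zvec N x)" for x
    using j poly_eq_scalar_prod_zvec[of R N x] by simp
  moreover have "b = c"
    if "b \<in> carrier_vec ((N + 1) div 2)" "\<forall>x. hermite k x = x * (b \<bullet> zvec N x)"
      "c \<in> carrier_vec ((N + 1) div 2)" "\<forall>x. hermite k x = x * (c \<bullet> zvec N x)" for b c
    using that by (intro zvec_coeffs_eqI[of b N c]) (auto, metis mult_left_cancel less_irrefl)
  ultimately show ?thesis
    by (intro ex1I[of _ "vec ((N + 1) div 2) (coeff R)"]) auto
qed

lemma hermite_even_coeffs_ex1:
  assumes "even k" "k \<le> N" "odd N"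
  shows "\<exists>!b. b \<in> carrier_vec ((N + 1) div 2) \<and> (\<forall>x. hermite k x = b \<bullet> zvec N x)"
proof -
  from assms obtain j where k: "k = 2 * j" by (elim evenE)
  with assms have j: "j < (N + 1) div 2" by (auto elim!: oddE)
  from hermite_poly_ex[of j] obtain Q
    where "degree Q \<le> j" "\<And>x. hermite k x = poly Q (x\<^sup>2)"
    unfolding k by blast
  then have "hermite k x = vec ((N + 1) div 2) (coeff Q) \<bullet> zvec N x" for x
    using j poly_eq_scalar_prod_zvec[of Q N x] by simp
  moreover have "b = c"
    if "b \<in> carrier_vec ((N + 1) div 2)" "\<forall>x. hermite k x = b \<bullet> zvec N x"
      "c \<in> carrier_vec ((N + 1) div 2)" "\<forall>x. hermite k x = c \<bullet> zvec N x" for b c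
    using that by (intro zvec_coeffs_eqI[of b N c]) auto
  ultimately show ?thesis
    by (intro ex1I[of _ "vec ((N + 1) div 2) (coeff Q)"]) auto
qed

end

(* Entrywise the identity says (2i + 1) * beta_{2m-1}(i) = (2m - 1) * beta_{2m-2}(i), that is,
   H_{2m-1}' = (2m - 1) * H_{2m-2}, read off coefficient by coefficient. *)

theory Submission imports Defs begin

text \<open>Right multiplication by \<open>D\<close> scales columns and left multiplication scales
  rows, so the claim compares single entries. The comparison is the Appell property
  \<open>H_k' = k * H_(k-1)\<close> for odd \<open>k\<close>, with the derivative computed in two
  ways. Termwise, \<open>x ^ (2 * i + 1)\<close> contributes the factor \<open>2 * i + 1\<close>,
  which is the entry of \<open>D\<close>. Analytically, \<open>H_k\<close> is a sign times
  \<open>exp (x\<^sup>2 / 2)\<close> times the \<open>k\<close>-th derivative \<open>g k\<close> of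
  the Gaussian, and the recurrence \<open>g (n + 1) = - x * g n - n * g (n - 1)\<close> makes the
  product rule collapse. Both results are polynomials in \<open>x\<^sup>2\<close>, so their
  coefficient vectors agree.\<close>

lemma deriv_gauss_recurrence:
  fixes n :: nat
  defines "g \<equiv> \<lambda>n. (deriv ^^ n) (\<lambda>t. exp (- t\<^sup>2 / 2) :: real)"
  shows "(g n has_real_derivative g (Suc n) x) (at x)"
    and "g (Suc n) x = - x * g n x - real n * g (n - 1) x"
proof -
  have g0: "(g 0 has_real_derivative - x * g 0 x) (at x)" for x
    unfolding g_def by (auto intro!: derivative_eq_intros)
  have g_SucI: "g (Suc n) x = d" if "(g n has_real_derivative d) (at x)" for n x d
    using DERIV_imp_deriv[OF that] by (simp add: g_def)
  \<comment> \<open>\<open>deriv\<close> has a value even where no derivative exists, so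
    differentiability must be carried through the induction. The recurrence writes
    \<open>g (Suc n)\<close> in terms of \<open>g n\<close> and \<open>g (n - 1)\<close>, hence the
    claim about both.\<close>
  have main: "(\<forall>x. (g n has_real_derivative g (Suc n) x) (at x)) \<and>
    (\<forall>x. (g (n - 1) has_real_derivative g (Suc (n - 1)) x) (at x)) \<and>
    (\<forall>x. g (Suc n) x = - x * g n x - real n * g (n - 1) x)"
  proof (induction n)
    case 0
    show ?case using g0 g_SucI[OF g0] by simp
  next
    case (Suc n)
    have eq: "g (Suc n) = (\<lambda>x. - x * g n x - real n * g (n - 1) x)"
      using Suc.IH by blast
    have dn: "(g n has_real_derivative g (Suc n) x) (at x)" for x
      using Suc.IH by blast
    \<comment> \<open>At \<open>n = 0\<close> the truncated \<open>n - 1\<close> is \<open>0\<close>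
      and the derivative of \<open>g (n - 1)\<close> is not \<open>g n\<close>, but the factor
      \<open>real n\<close> vanishes.\<close>
    have dn': "((\<lambda>x. real n * g (n - 1) x) has_real_derivative real n * g n x) (at x)" for x
      using Suc.IH by (cases n) (auto intro!: DERIV_cmult)
    have "((\<lambda>x. - x * g n x - real n * g (n - 1) x) has_real_derivative
        (- 1 * g n x + g (Suc n) x * - x) - real n * g n x) (at x)" for x
      by (intro DERIV_diff DERIV_mult DERIV_minus DERIV_ident dn dn')
    then have "(g (Suc n) has_real_derivative
        (- 1 * g n x + g (Suc n) x * - x) - real n * g n x) (at x)" for x
      unfolding eq[symmetric] .
    \<comment> \<open>Collecting the two multiples of \<open>g n\<close> into
      \<open>- (n + 1) * g n\<close> yields the recurrence at \<open>Suc n\<close>.\<close>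
    then have d: "(g (Suc n) has_real_derivative - x * g (Suc n) x - real (Suc n) * g n x) (at x)" for x
      by (rule DERIV_cong) (simp add: algebra_simps)
    have "g (Suc (Suc n)) x = - x * g (Suc n) x - real (Suc n) * g n x" for x
      by (rule g_SucI[OF d])
    with d dn show ?case by (simp only: diff_Suc_1) simp
  qed
  show "(g n has_real_derivative g (Suc n) x) (at x)"
    using main[THEN conjunct1] by (rule spec)
  show "g (Suc n) x = - x * g n x - real n * g (n - 1) x"
    using main[THEN conjunct2, THEN conjunct2] by (rule spec)
qed

text \<open>The product rule produces \<open>x * g n + g (Suc n)\<close>, which the recurrence
  reduces to \<open>- n * g (n - 1)\<close>; the minus sign turns \<open>(- 1) ^ n\<close> into the
  sign of \<open>H_(n-1)\<close>.\<close>

lemma has_real_derivative_hermite: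
  "(hermite n has_real_derivative real n * hermite (n - 1) x) (at x)"
proof -
  define g where "g n = (deriv ^^ n) (\<lambda>t. exp (- t\<^sup>2 / 2) :: real)" for n
  have g: "(g n has_real_derivative g (Suc n) x) (at x)"
    "g (Suc n) x = - x * g n x - real n * g (n - 1) x"
    unfolding g_def by (rule deriv_gauss_recurrence)+
  have h: "hermite k = (\<lambda>x. (- 1) ^ k * exp (x\<^sup>2 / 2) * g k x)" for k
    by (simp add: hermite_def fun_eq_iff g_def)
  have "((\<lambda>x. (- 1) ^ n * exp (x\<^sup>2 / 2) * g n x) has_real_derivative
      (- 1) ^ n * (x * exp (x\<^sup>2 / 2)) * g n x + (- 1) ^ n * exp (x\<^sup>2 / 2) * g (Suc n) x) (at x)"
    by (auto intro!: derivative_eq_intros g(1))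
  moreover have "(- 1) ^ n * (x * exp (x\<^sup>2 / 2)) * g n x + (- 1) ^ n * exp (x\<^sup>2 / 2) * g (Suc n) x
      = real n * hermite (n - 1) x"
    unfolding g(2) h by (cases n) (simp_all add: algebra_simps)
  ultimately show ?thesis
    by (simp add: h)
qed

text \<open>Existence and uniqueness of the described vector release the defining properties from
  the \<open>THE\<close> operator.\<close>

lemma hermite_coeffs_odd:
  assumes "odd k" "k \<le> N"
  shows "hermite_coeffs k N \<in> carrier_vec ((N + 1) div 2)"
    and "hermite k x = x * (hermite_coeffs k N \<bullet> zvec N x)"
proof -
  have "hermite_coeffs k N = (THE b. b \<in> carrier_vec ((N + 1) div 2) \<and>
      (\<forall>x. hermite k x = x * (b \<bullet> zvec N x)))"
    using assms(1) unfolding hermite_coeffs_def by (simp only: if_True if_False not_True_eq_False not_False_eq_True)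
  note b = theI'[OF hermite_odd_coeffs_ex1[OF assms], folded this]
  show "hermite_coeffs k N \<in> carrier_vec ((N + 1) div 2)"
    by (rule conjunct1[OF b])
  show "hermite k x = x * (hermite_coeffs k N \<bullet> zvec N x)"
    by (rule spec[OF conjunct2[OF b]])
qed

lemma hermite_coeffs_even:
  assumes "even k" "k \<le> N" "odd N"
  shows "hermite_coeffs k N \<in> carrier_vec ((N + 1) div 2)"
    and "hermite k x = hermite_coeffs k N \<bullet> zvec N x"
proof -
  have "hermite_coeffs k N = (THE b. b \<in> carrier_vec ((N + 1) div 2) \<and>
      (\<forall>x. hermite k x = b \<bullet> zvec N x))"
    using assms(1) unfolding hermite_coeffs_def by (simp only: if_True if_False not_True_eq_False not_False_eq_True)
  note b = theI'[OF hermite_even_coeffs_ex1[OF assms], folded this]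
  show "hermite_coeffs k N \<in> carrier_vec ((N + 1) div 2)"
    by (rule conjunct1[OF b])
  show "hermite k x = hermite_coeffs k N \<bullet> zvec N x"
    by (rule spec[OF conjunct2[OF b]])
qed

text \<open>Differentiating the odd monomials one by one is the source of the diagonal entries of
  \<open>D\<close>.\<close>

lemma has_real_derivative_odd_scalar_prod_zvec:
  "((\<lambda>x. x * (b \<bullet> zvec N x)) has_real_derivative
    vec ((N + 1) div 2) (\<lambda>i. real (2 * i + 1) * b $ i) \<bullet> zvec N x) (at x)"
proof -
  have "((\<lambda>x. \<Sum>i<(N + 1) div 2. b $ i * x ^ (2 * i + 1)) has_real_derivative
      (\<Sum>i<(N + 1) div 2. real (2 * i + 1) * b $ i * x ^ (2 * i))) (at x)"
  proof (rule DERIV_sum)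
    show "((\<lambda>x. b $ i * x ^ (2 * i + 1)) has_real_derivative
        real (2 * i + 1) * b $ i * x ^ (2 * i)) (at x)" for i
      using DERIV_cmult[OF DERIV_pow[of "2 * i + 1" x], of "b $ i"] by (simp add: mult_ac)
  qed
  moreover have "x * (b \<bullet> zvec N x) = (\<Sum>i<(N + 1) div 2. b $ i * x ^ (2 * i + 1))" for x
    by (simp add: scalar_prod_def zvec_def sum_distrib_left atLeast0LessThan mult_ac)
  ultimately show ?thesis
    by (simp add: scalar_prod_def zvec_def atLeast0LessThan)
qed

lemma hermite_coeffs_odd_even:
  assumes "odd k" "k \<le> N" "odd N" "i < (N + 1) div 2"
  shows "real (2 * i + 1) * hermite_coeffs k N $ i = real k * hermite_coeffs (k - 1) N $ i"
proof -
  define b where "b = hermite_coeffs k N"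
  define a where "a = hermite_coeffs (k - 1) N"
  have k1: "even (k - 1)" "k - 1 \<le> N"
    using assms by auto
  note a = hermite_coeffs_even[OF k1 assms(3), folded a_def]
  have "hermite k = (\<lambda>x. x * (b \<bullet> zvec N x))"
    using hermite_coeffs_odd(2)[OF assms(1,2)] unfolding b_def by blast
  \<comment> \<open>Both sides are the derivative of \<open>H_k\<close>: the left one termwise, the
    right one by the Appell property.\<close>
  then have "vec ((N + 1) div 2) (\<lambda>i. real (2 * i + 1) * b $ i) \<bullet> zvec N x
      = real k * hermite (k - 1) x" for x
    using DERIV_unique[OF has_real_derivative_odd_scalar_prod_zvec[of b N x]]
      has_real_derivative_hermite[of k x] by simp
  moreover have "real k * hermite (k - 1) x = (real k \<cdot>\<^sub>v a) \<bullet> zvec N x" for x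
    using a(1) unfolding a(2) by (intro smult_scalar_prod_distrib[symmetric]) (auto simp: zvec_def)
  \<comment> \<open>Two vectors with the same pairing against \<open>zvec N x\<close> for all
    positive \<open>x\<close> coincide.\<close>
  ultimately have "vec ((N + 1) div 2) (\<lambda>i. real (2 * i + 1) * b $ i) = real k \<cdot>\<^sub>v a"
    using a(1) by (intro zvec_coeffs_eqI[of _ N]) auto
  from arg_cong[where f = "\<lambda>v. v $ i", OF this] show ?thesis
    using assms(4) a(1) unfolding a_def b_def by simp
qed

theorem lemma2:
  fixes M N :: nat and D L\<^sub>a L\<^sub>b :: "real mat"
  assumes "M \<ge> 1" and "N = 2 * M - 1"
    and "D = mat_diag M (\<lambda>i. real (2 * i + 1))"
    and "L\<^sub>b = mat_of_rows M (map (\<lambda>m. hermite_coeffs (2 * m - 1) N) [1..<M + 1])"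
    and "L\<^sub>a = mat_of_rows M (map (\<lambda>m. hermite_coeffs (2 * m - 2) N) [1..<M + 1])"
  shows "L\<^sub>b * D = D * L\<^sub>a"
proof (rule eq_matI)
  have N: "odd N" "(N + 1) div 2 = M"
    using assms(1,2) by auto
  have L: "L\<^sub>b \<in> carrier_mat M M" "L\<^sub>a \<in> carrier_mat M M"
    unfolding assms(4,5) by (simp_all add: carrier_matI)
  have D: "D \<in> carrier_mat M M"
    by (simp add: assms(3))
  show "dim_row (L\<^sub>b * D) = dim_row (D * L\<^sub>a)" "dim_col (L\<^sub>b * D) = dim_col (D * L\<^sub>a)"
    using L D by auto
  fix i j
  assume "i < dim_row (D * L\<^sub>a)" and "j < dim_col (D * L\<^sub>a)"
  then have ij: "i < M" "j < M"
    using L D by auto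
  then have "real (2 * j + 1) * hermite_coeffs (2 * i + 1) N $ j
      = real (2 * i + 1) * hermite_coeffs (2 * i) N $ j"
    using hermite_coeffs_odd_even[of "2 * i + 1" N j] assms(2) N by simp
  \<comment> \<open>Rows are indexed from 0 while \<open>m\<close> starts at 1, so row
    \<open>i\<close> belongs to \<open>m = i + 1\<close>, giving degrees \<open>2 * i + 1\<close>
    and \<open>2 * i\<close>.\<close>
  moreover have "L\<^sub>b $$ (i, j) = hermite_coeffs (2 * i + 1) N $ j"
    "L\<^sub>a $$ (i, j) = hermite_coeffs (2 * i) N $ j"
    using ij unfolding assms(4,5) by (simp_all add: mat_of_rows_def del: upt_Suc)
  \<comment> \<open>The left entry picks up the column factor \<open>2 * j + 1\<close>, the right
    entry the row factor \<open>2 * i + 1\<close>.\<close>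
  ultimately show "(L\<^sub>b * D) $$ (i, j) = (D * L\<^sub>a) $$ (i, j)"
    using ij L unfolding assms(3) by (simp add: mat_diag_mult_left[OF L(2)] mat_diag_mult_right[OF L(1)] mult.commute)
qed

end
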